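(* Let $k,n$ be integers with $0\le k\le n$. Then, for all complex $x$ with $|x|<\tfrac12$, $$Hl\left(\tfrac12,(2k+1)(k-n);\,2(k-n),\,2k+1;\,2k+2,\,2k+2;\,x\right)=4^k\,\frac{2k+1}{n+1}\binom{n+k+1}{n}^{-1}\binom{n}{k}^{-1}\sum_{j=0}^{n-k}\binom{2k+2j+2}{2j}\binom{n+1}{k+j+1}r_{nj}(1-2x)^{2n-2k-2j}$$ and $$Hl\left(\tfrac12,(2k+1)(k-n);\,2(k-n),\,2k+1;\,2k+2,\,2k+2;\,x\right)=\sum_{j=0}^{n-k}4^j\binom{n-k}{j}\frac{(k+1/2)_j}{(2k+2)_j}(x^2-x)^j.$$
   Context: Heun function: for $a\notin\{0,1\}$, $\gamma\notin\{0,-1,-2,\dots\}$ and $\epsilon$ defined by $\alpha+\beta+1=\gamma+\delta+\epsilon$, $Hl(a,q;\alpha,\beta;\gamma,\delta;x)$ denotes the (local) Heun function, i.e. the solution $u(x)$, analytic near $x=0$ and normalized by $u(0)=1$, of $$u''(x)+\left(\frac{\gamma}{x}+\frac{\delta}{x-1}+\frac{\epsilon}{x-a}\right)u'(x)+\frac{\alpha\beta x-q}{x(x-1)(x-a)}u(x)=0.$$ (For $a=\tfrac12$ its power series at $0$ converges for $|x|<\tfrac12$.) Notation: $(y)_0:=1$, $(y)_l:=y(y+1)\cdots(y+l-1)$ for $l\ge1$; for $0\le j\le n$, $r_{nj}:=\binom{n}{j}^{-1}4^{-n}\binom{2j}{j}\binom{2n-2j}{n-j}$. *)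

theory Defs
  imports "HOL-Analysis.Analysis"
begin

text \<open>
  The exponent parameter at the singularity \<open>x = a\<close> is eliminated through
  \<open>\<alpha> + \<beta> + 1 = \<gamma> + \<delta> + \<epsilon>\<close>.  The equation is required on a punctured neighbourhood
  of \<open>0\<close>, where its coefficients are defined.
\<close>

definition local_heun_solution ::
  "complex \<Rightarrow> complex \<Rightarrow> complex \<Rightarrow> complex \<Rightarrow> complex \<Rightarrow> complex \<Rightarrow> (complex \<Rightarrow> complex) \<Rightarrow> bool"
where
  "local_heun_solution a q \<alpha> \<beta> \<gamma> \<delta> u \<longleftrightarrow>
     u analytic_on {0} \<and> u 0 = 1 \<and>
     (let \<epsilon> = \<alpha> + \<beta> + 1 - \<gamma> - \<delta> in
      \<forall>\<^sub>F x in at 0.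
        deriv (deriv u) x
        + (\<gamma> / x + \<delta> / (x - 1) + \<epsilon> / (x - a)) * deriv u x
        + (\<alpha> * \<beta> * x - q) / (x * (x - 1) * (x - a)) * u x = 0)"

text \<open>
  For \<open>a \<notin> {0, 1}\<close> and \<open>\<gamma> \<notin> {0, -1, -2, \<dots>}\<close> the germ at \<open>0\<close> of such a solution exists
  and is unique.  The local Heun function is the sum of its power series at \<open>0\<close>; the
  definition is meaningful only for such parameters and within the disc of convergence.
\<close>

definition Heun_fps ::
  "complex \<Rightarrow> complex \<Rightarrow> complex \<Rightarrow> complex \<Rightarrow> complex \<Rightarrow> complex \<Rightarrow> complex fps"
where
  "Heun_fps a q \<alpha> \<beta> \<gamma> \<delta> =
     (THE F. \<exists>u. local_heun_solution a q \<alpha> \<beta> \<gamma> \<delta> u \<and> u has_fps_expansion F)"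

definition Hl ::
  "complex \<Rightarrow> complex \<Rightarrow> complex \<Rightarrow> complex \<Rightarrow> complex \<Rightarrow> complex \<Rightarrow> complex \<Rightarrow> complex"
where
  "Hl a q \<alpha> \<beta> \<gamma> \<delta> x = eval_fps (Heun_fps a q \<alpha> \<beta> \<gamma> \<delta>) x"

definition r :: "nat \<Rightarrow> nat \<Rightarrow> complex" where
  "r n j = inverse (of_nat (n choose j)) * inverse (4 ^ n)
     * of_nat ((2 * j) choose j) * of_nat ((2 * n - 2 * j) choose (n - j))"

end

theory Submission
  imports Defs "HOL-Complex_Analysis.Laurent_Convergence"
begin

text \<open>
  With \<open>a = 1/2\<close>, \<open>q = \<alpha> \<beta> / 2\<close> and \<open>\<gamma> = \<delta>\<close> the Heun equation is invariant under
  \<open>x \<mapsto> 1 - x\<close>, so it descends to the quotient variable \<open>w = x\<^sup>2 - x\<close>.  The singularity at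
  \<open>1/2\<close> is the branch point of this quotient, and what remains is the hypergeometric equation with
  parameters \<open>\<alpha>/2, \<beta>/2; \<gamma>\<close> in the variable \<open>-4 w\<close>
  (lemma \<open>heun_symmetric_quadratic_substitution\<close>).  For \<open>\<alpha> = 2 (k - n)\<close> the hypergeometric series
  terminates, and the resulting polynomial in \<open>w\<close> is the second formula.

  That this polynomial is the local Heun function requires uniqueness of the germ at \<open>0\<close>.  It is
  obtained by passing to formal power series: the lowest coefficient of the Heun equation
  involves only the indicial factor \<open>a s (s - 1 + \<gamma>)\<close>, which for \<open>\<gamma> \<notin> {0, -1, -2, \<dots>}\<close> does not vanish when \<open>s > 0\<close>
  (lemma \<open>fps_heun_ode_unique\<close>), so a solution without constant term is zero.

  The first formula is the expansion of the same polynomial at \<open>x = 1/2\<close>.  Since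
  \<open>-4 w = 1 - y\<close> for \<open>y = (1 - 2 x)\<^sup>2\<close>, this is the passage from \<open>1 - y\<close> to \<open>y\<close> in a terminating
  hypergeometric sum, where each coefficient is a Chu--Vandermonde sum
  (lemma \<open>hypergeometric_sum_reflect\<close>).  The Pochhammer symbols that arise have half-integer
  arguments, and writing these as quotients of factorials produces the central binomial
  coefficients in \<open>r\<close> (lemma \<open>binomial_r_eq_pochhammer\<close>).
\<close>

section \<open>Uniqueness of the power series solution of the Heun equation\<close>

text \<open>
  The Heun operator multiplied by \<open>x (x - 1) (x - a)\<close>, which clears the denominators and lets it
  act on formal power series; \<open>p\<close> stands for \<open>\<alpha> \<beta>\<close>.
\<close>
definition heun_operator ::
  "'a \<Rightarrow> 'a \<Rightarrow> 'a \<Rightarrow> 'a \<Rightarrow> 'a \<Rightarrow> 'a \<Rightarrow> 'a :: field_char_0 fps \<Rightarrow> 'a fps" where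
  "heun_operator a q p \<gamma> \<delta> \<epsilon> F =
         fps_X * (fps_X - 1) * (fps_X - fps_const a) * fps_deriv (fps_deriv F)
         + (fps_const \<gamma> * ((fps_X - 1) * (fps_X - fps_const a))
            + fps_const \<delta> * (fps_X * (fps_X - fps_const a))
            + fps_const \<epsilon> * (fps_X * (fps_X - 1))) * fps_deriv F
         + (fps_const p * fps_X - fps_const q) * F"

lemma heun_operator_diff:
  "heun_operator a q p \<gamma> \<delta> \<epsilon> (F - G) = heun_operator a q p \<gamma> \<delta> \<epsilon> F - heun_operator a q p \<gamma> \<delta> \<epsilon> G"
  unfolding heun_operator_def fps_deriv_sub right_diff_distrib by simp

text \<open>
  The differential equation holds only on a punctured neighbourhood, where it does not determine a
  value at \<open>0\<close>.  Laurent expansions depend on punctured neighbourhoods alone, so uniqueness of the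
  Laurent expansion of \<open>0\<close> gives the identity of power series.
\<close>
lemma local_heun_solution_fps_ode:
  assumes sol: "local_heun_solution a q \<alpha> \<beta> \<gamma> \<delta> u" and F: "u has_fps_expansion F"
    and a: "a \<noteq> 0" "a \<noteq> 1"
  shows "heun_operator a q (\<alpha> * \<beta>) \<gamma> \<delta> (\<alpha> + \<beta> + 1 - \<gamma> - \<delta>) F = 0" (is "?G = 0")
proof -
  define g where "g x = x * (x - 1) * (x - a) * deriv (deriv u) x
         + (\<gamma> * ((x - 1) * (x - a)) + \<delta> * (x * (x - a))
            + (\<alpha> + \<beta> + 1 - \<gamma> - \<delta>) * (x * (x - 1))) * deriv u x
         + (\<alpha> * \<beta> * x - q) * u x" for x
  have "g has_fps_expansion ?G"
    unfolding g_def heun_operator_def by (intro fps_expansion_intros F)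
  then have "g has_laurent_expansion fps_to_fls ?G"
    by (rule has_fps_expansion_to_laurent[THEN iffD1, THEN conjunct1])
  moreover have "eventually (\<lambda>x. g x = 0) (at 0)"
  proof -
    have "eventually (\<lambda>x. x \<in> - {0, 1, a}) (at (0::complex))"
      by (auto intro!: eventually_conj eventually_neq_at_within)
    with sol[unfolded local_heun_solution_def Let_def, THEN conjunct2, THEN conjunct2]
    show ?thesis
    proof eventually_elim
      case (elim x)
      define D2 D1 where "D2 = deriv (deriv u) x" and "D1 = deriv u x"
      define e where "e = \<alpha> + \<beta> + 1 - \<gamma> - \<delta>"
      have nz: "x \<noteq> 0" "x - 1 \<noteq> 0" "x - a \<noteq> 0" using elim by auto
      have "g x = x * (x - 1) * (x - a) * (D2
          + (\<gamma> / x + \<delta> / (x - 1) + e / (x - a)) * D1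
          + (\<alpha> * \<beta> * x - q) / (x * (x - 1) * (x - a)) * u x)"
        unfolding g_def D2_def[symmetric] D1_def[symmetric] e_def[symmetric]
        using nz by (simp add: divide_simps) (simp add: algebra_simps)
      also have "\<dots> = 0"
        using elim by (simp add: D2_def D1_def e_def)
      finally show ?case .
    qed
  qed
  ultimately have "(\<lambda>_. 0) has_laurent_expansion fps_to_fls ?G"
    by (subst has_laurent_expansion_cong[of _ g _ "fps_to_fls ?G"])
       (auto elim: eventually_mono)
  then have "fps_to_fls ?G = 0"
    using has_laurent_expansion_unique has_laurent_expansion_0 by blast
  then show ?thesis by (simp only: fps_to_fls_eq_0_iff)
qed

text \<open>
  Only \<open>a x u''\<close> and \<open>a \<gamma> u'\<close> lower the degree by one; all other terms of the equation keep or raise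
  it.  So the coefficient of degree \<open>s\<close> expresses
  \<open>a (s + 1) (s + \<gamma>)\<close> times coefficient \<open>s + 1\<close> of the solution by earlier coefficients.
\<close>
lemma fps_heun_ode_unique:
  fixes D :: "'a :: field_char_0 fps"
  assumes ode: "heun_operator a q p \<gamma> \<delta> \<epsilon> D = 0"
    and a: "a \<noteq> 0" and \<gamma>: "\<And>n. \<gamma> \<noteq> - of_nat n" and D0: "fps_nth D 0 = 0"
  shows "D = 0"
proof (rule fps_ext)
  fix n
  show "fps_nth D n = fps_nth 0 n"
  proof (induction n rule: less_induct)
    case (less n)
    show ?case
    proof (cases n)
      case 0
      then show ?thesis using D0 by simp
    next
      case (Suc s)
      have low: "fps_nth D i = 0" if "i \<le> s" for i
        using less that Suc by simp
      \<comment> \<open>The degree-lowering terms are isolated on the left.\<close>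
      have exp: "fps_X * (fps_const a * fps_deriv (fps_deriv D))
        + fps_const (\<gamma> * a) * fps_deriv D
        = fps_X * (fps_X * (fps_const (1 + a) * fps_deriv (fps_deriv D)))
        - fps_X * (fps_X * (fps_X * fps_deriv (fps_deriv D)))
        + fps_X * (fps_const (\<gamma> * (1 + a) + \<delta> * a + \<epsilon>) * fps_deriv D)
        - fps_X * (fps_X * (fps_const (\<gamma> + \<delta> + \<epsilon>) * fps_deriv D))
        - fps_X * (fps_const p * D) + fps_const q * D" (is "?L = ?R")
        using ode by (simp add: heun_operator_def algebra_simps flip: fps_const_add fps_const_mult)
      have "fps_nth ?L s = fps_nth ?R s" by (simp only: exp)
      moreover have "fps_nth ?R s = 0"
        by (auto simp: low)
      moreover have "fps_nth ?L s = a * of_nat (Suc s) * (of_nat s + \<gamma>) * fps_nth D (Suc s)"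
        by (cases s) (auto simp: algebra_simps)
      moreover have "of_nat s + \<gamma> \<noteq> 0"
        using \<gamma>[of s] by (metis add.commute eq_neg_iff_add_eq_0)
      ultimately show ?thesis
        using a Suc by (simp del: of_nat_Suc)
    qed
  qed
qed

text \<open>
  The description operator behind \<open>Hl\<close> is well defined because the difference of two expansions
  solves the linear equation and has no constant term.
\<close>
lemma Hl_eqI:
  assumes sol: "local_heun_solution a q \<alpha> \<beta> \<gamma> \<delta> u" and F: "u has_fps_expansion F"
    and a: "a \<noteq> 0" "a \<noteq> 1" and \<gamma>: "\<And>n. \<gamma> \<noteq> - of_nat n"
  shows "Hl a q \<alpha> \<beta> \<gamma> \<delta> x = eval_fps F x"
proof -
  have "Heun_fps a q \<alpha> \<beta> \<gamma> \<delta> = F"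
    unfolding Heun_fps_def
  proof (rule the_equality)
    show "\<exists>u. local_heun_solution a q \<alpha> \<beta> \<gamma> \<delta> u \<and> u has_fps_expansion F"
      using sol F by blast
  next
    fix G assume "\<exists>v. local_heun_solution a q \<alpha> \<beta> \<gamma> \<delta> v \<and> v has_fps_expansion G"
    then obtain v where v: "local_heun_solution a q \<alpha> \<beta> \<gamma> \<delta> v" "v has_fps_expansion G"
      by blast
    have 1: "fps_nth G 0 = v 0" "fps_nth F 0 = u 0"
      using v(2) F by (simp_all add: has_fps_expansion_imp_0_eq_fps_nth_0)
    have "G - F = 0"
    proof (rule fps_heun_ode_unique[OF _ a(1) \<gamma>])
      show "fps_nth (G - F) 0 = 0"
        using 1 sol v(1) by (simp add: local_heun_solution_def)
      show "heun_operator a q (\<alpha> * \<beta>) \<gamma> \<delta> (\<alpha> + \<beta> + 1 - \<gamma> - \<delta>) (G - F) = 0"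
        by (simp add: heun_operator_diff local_heun_solution_fps_ode[OF sol F a]
              local_heun_solution_fps_ode[OF v a])
    qed
    then show "G = F" by simp
  qed
  then show ?thesis by (simp add: Hl_def)
qed

section \<open>The symmetric case and the hypergeometric equation\<close>

text \<open>
  For \<open>u(x) = p(w)\<close> with \<open>w = x\<^sup>2 - x\<close> one has \<open>u' = (2 x - 1) p'\<close> and
  \<open>u'' = (1 + 4 w) p'' + 2 p'\<close>, as \<open>(2 x - 1)\<^sup>2 = 1 + 4 w\<close>.  The factor \<open>2 x - 1\<close> of \<open>u'\<close> cancels
  the pole at \<open>1/2\<close>, and \<open>q = \<alpha> \<beta> / 2\<close> makes \<open>\<alpha> \<beta> x - q\<close> cancel it in the last term.
\<close>
lemma heun_symmetric_quadratic_substitution: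
  fixes p :: "complex poly"
  assumes ode: "[:0, 1, 4:] * pderiv (pderiv p) + [:\<gamma>, 2 * \<alpha> + 2 * \<beta> + 4:] * pderiv p
                + smult (\<alpha> * \<beta>) p = 0"
    and p0: "poly p 0 = 1"
  shows "local_heun_solution (1/2) (\<alpha> * \<beta> / 2) \<alpha> \<beta> \<gamma> \<gamma> (poly (pcompose p [:0, -1, 1:]))"
proof -
  define P where "P = pcompose p [:0, -1, 1:]"
  have d: "deriv (poly Q) = poly (pderiv Q)" for Q :: "complex poly"
    by (intro ext DERIV_imp_deriv poly_DERIV)
  have 1: "deriv (poly P) x = poly (pderiv p) (x\<^sup>2 - x) * (2 * x - 1)"
    and 2: "deriv (deriv (poly P)) x
        = poly (pderiv (pderiv p)) (x\<^sup>2 - x) * (2 * x - 1)\<^sup>2 + 2 * poly (pderiv p) (x\<^sup>2 - x)" for x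
    unfolding d by (simp_all add: P_def pderiv_pcompose pderiv_mult pderiv_add
        pderiv_diff pderiv_smult poly_pcompose pderiv_pCons
        power2_eq_square algebra_simps)
  have 0: "poly P x = poly p (x\<^sup>2 - x)" for x
    by (simp add: P_def poly_pcompose power2_eq_square algebra_simps)
  have "eventually (\<lambda>x. x \<noteq> 0 \<and> x \<noteq> 1 \<and> x \<noteq> 1/2) (at (0::complex))"
    by (intro eventually_conj eventually_neq_at_within)
  then have "eventually (\<lambda>x. deriv (deriv (poly P)) x
        + (\<gamma> / x + \<gamma> / (x - 1) + (\<alpha> + \<beta> + 1 - \<gamma> - \<gamma>) / (x - 1/2)) * deriv (poly P) x
        + (\<alpha> * \<beta> * x - \<alpha> * \<beta> / 2) / (x * (x - 1) * (x - 1/2)) * poly P x = 0) (at 0)"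
  proof eventually_elim
    case (elim x)
    define w where "w = x\<^sup>2 - x"
    define A B C where "A = poly (pderiv (pderiv p)) w" and "B = poly (pderiv p) w" and "C = poly p w"
    have nz: "x \<noteq> 0" "x - 1 \<noteq> 0" "2 * x - 1 \<noteq> 0" "x - 1/2 \<noteq> 0" using elim by (auto simp: field_simps)
    have w: "w = x * (x - 1)" "w \<noteq> 0" using nz by (auto simp: w_def power2_eq_square algebra_simps)
    have sq: "(2 * x - 1)\<^sup>2 = 1 + 4 * w" by (simp add: w_def power2_eq_square algebra_simps)
    have "poly ([:0, 1, 4:] * pderiv (pderiv p) + [:\<gamma>, 2 * \<alpha> + 2 * \<beta> + 4:] * pderiv p
                + smult (\<alpha> * \<beta>) p) w = 0"
      by (simp only: ode poly_0)
    then have h: "w * (1 + 4 * w) * A + (\<gamma> + (2 * \<alpha> + 2 * \<beta> + 4) * w) * B + \<alpha> * \<beta> * C = 0"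
      by (simp add: A_def B_def C_def algebra_simps)
    have c1: "(\<gamma> / x + \<gamma> / (x - 1) + (\<alpha> + \<beta> + 1 - \<gamma> - \<gamma>) / (x - 1/2)) * (2 * x - 1)
        = \<gamma> * (1 + 4 * w) / w + 2 * (\<alpha> + \<beta> + 1 - \<gamma> - \<gamma>)"
    proof -
      have "\<gamma> / x + \<gamma> / (x - 1) = \<gamma> * (2 * x - 1) / w"
        using nz by (simp add: w(1) divide_simps) (simp add: algebra_simps)
      moreover have "1 / (x - 1/2) * (2 * x - 1) = 2"
        using nz by (simp add: field_simps)
      moreover have "(s + e / (x - 1/2)) * (2 * x - 1)
          = s * (2 * x - 1) + e * (1 / (x - 1/2) * (2 * x - 1))" for s e
        by (simp add: ring_distribs)
      ultimately show ?thesis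
        by (simp only: sq[symmetric] power2_eq_square) (simp add: mult_ac)
    qed
    have c0: "(\<alpha> * \<beta> * x - \<alpha> * \<beta> / 2) / (x * (x - 1) * (x - 1/2)) = \<alpha> * \<beta> / w"
    proof -
      have "\<alpha> * \<beta> * x - \<alpha> * \<beta> / 2 = \<alpha> * \<beta> * (x - 1/2)" by (simp add: algebra_simps)
      then show ?thesis using nz by (simp add: w(1))
    qed
    have "deriv (deriv (poly P)) x
        + (\<gamma> / x + \<gamma> / (x - 1) + (\<alpha> + \<beta> + 1 - \<gamma> - \<gamma>) / (x - 1/2)) * deriv (poly P) x
        + (\<alpha> * \<beta> * x - \<alpha> * \<beta> / 2) / (x * (x - 1) * (x - 1/2)) * poly P x
      = A * (1 + 4 * w) + 2 * B
        + (\<gamma> * (1 + 4 * w) / w + 2 * (\<alpha> + \<beta> + 1 - \<gamma> - \<gamma>)) * B + \<alpha> * \<beta> / w * C"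
      unfolding 0 1 2 c0 c1[symmetric] w_def[symmetric] sq A_def B_def C_def by (simp add: mult_ac)
    also have "\<dots> = (w * (1 + 4 * w) * A + (\<gamma> + (2 * \<alpha> + 2 * \<beta> + 4) * w) * B + \<alpha> * \<beta> * C) / w"
      using w(2) by (simp add: divide_simps) (simp add: algebra_simps)
    finally show ?case by (simp only: h) simp
  qed
  moreover have "poly P analytic_on {0}"
    by (rule analytic_on_subset[OF _ subset_UNIV])
       (auto simp: analytic_on_open intro!: holomorphic_intros)
  ultimately show ?thesis
    using p0 by (simp add: local_heun_solution_def Let_def 0 P_def[symmetric])
qed

text \<open>The terminating series \<open>\<^sub>2F\<^sub>1(-m, b; c; -4 w)\<close> as a polynomial in \<open>w\<close>.\<close>
definition hypergeometric_poly :: "nat \<Rightarrow> complex \<Rightarrow> complex \<Rightarrow> complex poly" where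
  "hypergeometric_poly m b c = (\<Sum>j\<le>m. monom (4 ^ j * of_nat (m choose j)
       * (pochhammer b j / pochhammer c j)) j)"

lemma coeff_hypergeometric_poly:
  "coeff (hypergeometric_poly m b c) j = 4 ^ j * of_nat (m choose j) * (pochhammer b j / pochhammer c j)"
  by (simp add: hypergeometric_poly_def coeff_sum coeff_monom if_distrib cong: if_cong)

text \<open>
  Comparing coefficients of \<open>w\<^sup>j\<close> leaves the two-term recurrence of the hypergeometric coefficients.
\<close>
lemma hypergeometric_poly_ode:
  assumes c: "\<And>n. c \<noteq> - of_nat n"
  shows "[:0, 1, 4:] * pderiv (pderiv (hypergeometric_poly m b c))
       + [:c, 4 * (b + 1 - of_nat m):] * pderiv (hypergeometric_poly m b c)
       + smult (- (4 * of_nat m * b)) (hypergeometric_poly m b c) = 0"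
proof (rule poly_eqI)
  fix j
  define h where "h = coeff (hypergeometric_poly m b c)"
  have step: "of_nat (Suc j) * (of_nat j + c) * h (Suc j)
      = 4 * (of_nat m - of_nat j) * (of_nat j + b) * h j"
  proof -
    have nz: "pochhammer c j \<noteq> 0" "c + of_nat j \<noteq> 0"
      using c by (auto simp: pochhammer_eq_0_iff eq_neg_iff_add_eq_0)
    have "Suc j * (m choose Suc j) = (m - j) * (m choose j)"
      by (simp only: binomial_absorption binomial_absorb_comp)
    then have "of_nat (Suc j) * of_nat (m choose Suc j) = (of_nat (m - j) * of_nat (m choose j) :: complex)"
      by (simp only: flip: of_nat_mult)
    also have "\<dots> = (of_nat m - of_nat j) * of_nat (m choose j)"
      by (cases "j \<le> m") (simp_all add: of_nat_diff)
    finally have "of_nat (Suc j) * of_nat (m choose Suc j) = ((of_nat m - of_nat j) * of_nat (m choose j) :: complex)" .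
    moreover have "(of_nat j + c) * h (Suc j)
        = of_nat (m choose Suc j) * (4 ^ Suc j * (pochhammer b (Suc j) / pochhammer c j))"
      unfolding h_def coeff_hypergeometric_poly pochhammer_Suc[of c] using nz by (simp add: add.commute)
    ultimately have "of_nat (Suc j) * (of_nat j + c) * h (Suc j)
       = ((of_nat m - of_nat j) * of_nat (m choose j)) * (4 ^ Suc j * (pochhammer b (Suc j) / pochhammer c j))"
      by (metis mult.assoc)
    then show ?thesis
      by (simp add: h_def coeff_hypergeometric_poly pochhammer_Suc mult_ac add.commute)
  qed
  show "coeff ([:0, 1, 4:] * pderiv (pderiv (hypergeometric_poly m b c))
       + [:c, 4 * (b + 1 - of_nat m):] * pderiv (hypergeometric_poly m b c)
       + smult (- (4 * of_nat m * b)) (hypergeometric_poly m b c)) j = coeff 0 j"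
    using step unfolding h_def
    by (cases j; cases "j - 1") (auto simp: coeff_pderiv coeff_pCons algebra_simps)
qed

section \<open>Terminating hypergeometric sums about the opposite singularity\<close>

lemma chu_vandermonde:
  fixes b c :: complex
  assumes c: "\<And>n. c \<noteq> - of_nat n"
  shows "(\<Sum>l=0..N. (-1) ^ l * of_nat (N choose l) * (pochhammer b l / pochhammer c l))
         = pochhammer (c - b) N / pochhammer c N"
proof -
  have "pochhammer (- of_nat N) l / fact l = ((-1) ^ l * of_nat (N choose l) :: complex)" for l
    by (simp add: binomial_gbinomial gbinomial_pochhammer flip: power_mult_distrib)
  then have "(-1) ^ l * of_nat (N choose l) * (pochhammer b l / pochhammer c l)
      = pochhammer b l * pochhammer (- of_nat N) l / (of_nat (fact l) * pochhammer c l)" for l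
    by (metis (no_types, lifting) of_nat_fact times_divide_times_eq mult.commute)
  then show ?thesis using c by (simp add: Vandermonde_pochhammer del: of_nat_fact)
qed

text \<open>
  Expanding \<open>(1 - y)\<^sup>j\<close> binomially and collecting the coefficient of \<open>y\<^sup>i\<close> leaves a sum over
  \<open>j = l + i\<close>.  Since \<open>(z)\<^bsub>l+i\<^esub> = (z)\<^sub>i (z + i)\<^sub>l\<close>, it is a Chu--Vandermonde sum with parameters
  \<open>b + i\<close> and \<open>c + i\<close>; the numerator depends on \<open>c - b\<close> only and is unaffected by the shift.
\<close>
lemma hypergeometric_sum_reflect:
  fixes b c :: complex
  assumes c: "\<And>n. c \<noteq> - of_nat n"
  shows "(\<Sum>j\<le>m. (-1) ^ j * of_nat (m choose j) * (pochhammer b j / pochhammer c j) * (1 - y) ^ j)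
       = (\<Sum>i\<le>m. of_nat (m choose i) * (pochhammer b i * pochhammer (c - b) (m - i) / pochhammer c m) * y ^ i)"
proof -
  define t where "t j = of_nat (m choose j) * (pochhammer b j / pochhammer c j)" for j
  have inner: "(\<Sum>j\<le>m. (-1) ^ (i + j) * of_nat (j choose i) * t j)
      = of_nat (m choose i) * (pochhammer b i * pochhammer (c - b) (m - i) / pochhammer c m)"
    if i: "i \<le> m" for i
  proof -
    have "(\<Sum>j\<le>m. (-1) ^ (i + j) * of_nat (j choose i) * t j)
        = (\<Sum>j=0+i..(m-i)+i. (-1) ^ (i + j) * of_nat (j choose i) * t j)"
      using i by (intro sum.mono_neutral_right) auto
    also have "\<dots> = (\<Sum>l=0..m-i. (-1) ^ (i + (l + i)) * of_nat ((l + i) choose i) * t (l + i))"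
      by (rule sum.shift_bounds_cl_nat_ivl)
    also have "\<dots> = (\<Sum>l=0..m-i. of_nat (m choose i) * (pochhammer b i / pochhammer c i) *
        ((-1) ^ l * of_nat ((m - i) choose l) * (pochhammer (b + of_nat i) l / pochhammer (c + of_nat i) l)))"
    proof (rule sum.cong)
      fix l assume l: "l \<in> {0..m - i}"
      have "(m choose (l + i)) * ((l + i) choose i) = (m choose i) * ((m - i) choose l)"
        using choose_mult[of i "l + i" m] l i by simp
      then have "of_nat (m choose (l + i)) * of_nat ((l + i) choose i)
          = (of_nat (m choose i) * of_nat ((m - i) choose l) :: complex)"
        by (simp flip: of_nat_mult)
      moreover have "(-1) ^ (i + (l + i)) = ((-1) ^ l :: complex)"
        by (simp add: power_add flip: power_mult_distrib)
      moreover have "pochhammer z (l + i) = pochhammer z i * pochhammer (z + of_nat i) l" for z :: complex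
        by (simp add: pochhammer_product' add.commute)
      ultimately show "(-1) ^ (i + (l + i)) * of_nat ((l + i) choose i) * t (l + i)
        = of_nat (m choose i) * (pochhammer b i / pochhammer c i) *
        ((-1) ^ l * of_nat ((m - i) choose l) * (pochhammer (b + of_nat i) l / pochhammer (c + of_nat i) l))"
        unfolding t_def by (simp add: mult_ac)
    qed simp
    also have "\<dots> = of_nat (m choose i) * (pochhammer b i / pochhammer c i) *
        (pochhammer (c - b) (m - i) / pochhammer (c + of_nat i) (m - i))"
    proof -
      have "c + of_nat i \<noteq> - of_nat n" for n
        using c[of "n + i"] by (auto simp: algebra_simps eq_neg_iff_add_eq_0)
      from chu_vandermonde[OF this, of "m - i" "b + of_nat i"] show ?thesis
        by (simp only: sum_distrib_left[symmetric]) simp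
    qed
    also have "\<dots> = of_nat (m choose i) * (pochhammer b i * pochhammer (c - b) (m - i) / pochhammer c m)"
      using pochhammer_product[OF i, of c] by simp
    finally show ?thesis .
  qed
  have "(1 - y) ^ j = (\<Sum>i\<le>m. of_nat (j choose i) * (-1) ^ i * y ^ i)" if "j \<le> m" for j
  proof -
    have "(1 - y) ^ j = (- y + 1) ^ j" by simp
    also have "\<dots> = (\<Sum>i\<le>j. of_nat (j choose i) * (-1) ^ i * y ^ i)"
      unfolding binomial_ring by (simp add: power_minus[of y] mult_ac)
    also have "\<dots> = (\<Sum>i\<le>m. of_nat (j choose i) * (-1) ^ i * y ^ i)"
      using that by (intro sum.mono_neutral_left) auto
    finally show ?thesis .
  qed
  then have "(\<Sum>j\<le>m. (-1) ^ j * t j * (1 - y) ^ j)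
      = (\<Sum>j\<le>m. \<Sum>i\<le>m. (-1) ^ (i + j) * of_nat (j choose i) * t j * y ^ i)"
    by (simp add: sum_distrib_left power_add mult_ac)
  also have "\<dots> = (\<Sum>i\<le>m. (\<Sum>j\<le>m. (-1) ^ (i + j) * of_nat (j choose i) * t j) * y ^ i)"
    by (subst sum.swap) (simp add: sum_distrib_right)
  also have "\<dots> = (\<Sum>i\<le>m. of_nat (m choose i)
      * (pochhammer b i * pochhammer (c - b) (m - i) / pochhammer c m) * y ^ i)"
    by (intro sum.cong) (simp_all only: inner atMost_iff)
  finally show ?thesis by (simp only: t_def mult.assoc)
qed

section \<open>The normalisation in terms of binomial coefficients\<close>

lemma pochhammer_half_integer:
  "pochhammer (of_nat k + 1/2 :: 'a :: field_char_0) j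
     = fact (2 * (k + j)) * fact k / (4 ^ j * fact (k + j) * fact (2 * k))"
proof (induction j)
  case (Suc j)
  have nz: "(fact (2 * k) :: 'a) \<noteq> 0" "(fact (k + j) :: 'a) \<noteq> 0" "(1 + of_nat (k + j) :: 'a) \<noteq> 0"
    by (simp_all, metis of_nat_Suc of_nat_eq_0_iff nat.distinct(1) of_nat_add)
  have e: "2 * (k + Suc j) = Suc (Suc (2 * (k + j)))" by simp
  show ?case
    unfolding pochhammer_Suc Suc.IH e fact_Suc add_Suc_right using nz
    by (simp add: divide_simps) (simp add: algebra_simps)
qed simp

text \<open>
  Write \<open>n = k + j + l\<close>.  All factors become quotients of factorials, and both sides reduce to the
  same quotient.  The powers of \<open>4\<close> agree because \<open>4\<^sup>k \<cdot> 4\<^bsup>-n\<^esup>\<close> is the product of the factors \<open>4\<^bsup>-l\<^esup>\<close> and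
  \<open>4\<^bsup>-j\<^esup>\<close> contributed by the two half-integer Pochhammer symbols.
\<close>
lemma binomial_r_eq_pochhammer:
  fixes k n j :: nat
  assumes "k \<le> n" "j \<le> n - k"
  shows "4 ^ k * ((2 * of_nat k + 1) / (of_nat n + 1))
           * inverse (of_nat ((n + k + 1) choose n)) * inverse (of_nat (n choose k))
           * (of_nat ((2 * k + 2 * j + 2) choose (2 * j))
                * of_nat ((n + 1) choose (k + j + 1)) * r n j)
       = of_nat ((n - k) choose j) * (pochhammer (of_nat k + 1/2) (n - k - j)
           * pochhammer (of_nat k + 3/2) j / pochhammer (2 * of_nat k + 2) (n - k))"
proof -
  obtain l where n: "n = k + j + l"
    using assms by (metis add.assoc le_Suc_ex le_add_diff_inverse)
  have p1: "pochhammer (of_nat k + 1/2 :: complex) l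
     = fact (2 * (k + l)) * fact k / (4 ^ l * fact (k + l) * fact (2 * k))"
    by (rule pochhammer_half_integer)
  have "of_nat k + 3/2 = (of_nat (k + 1) + 1/2 :: complex)" by simp
  then have p2: "pochhammer (of_nat k + 3/2 :: complex) j
     = fact (2 * k + 2 * j + 2) * fact (k + 1) / (4 ^ j * fact (k + j + 1) * fact (2 * k + 2))"
    using pochhammer_half_integer[of "k + 1" j, where 'a = complex] by (simp add: algebra_simps)
  have p3: "pochhammer (2 * of_nat k + 2 :: complex) (j + l) = fact (n + k + 1) / fact (2 * k + 1)"
  proof -
    have "(fact (n + k + 1) :: complex) = pochhammer 1 ((2 * k + 1) + (j + l))"
      unfolding pochhammer_fact by (rule arg_cong) (simp add: n)
    also have "\<dots> = fact (2 * k + 1) * pochhammer (2 * of_nat k + 2) (j + l)"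
      by (subst pochhammer_product') (simp add: pochhammer_fact algebra_simps)
    finally show ?thesis by (metis fact_nonzero nonzero_mult_div_cancel_left)
  qed
  have b1: "(of_nat ((n + k + 1) choose n) :: complex) = fact (n + k + 1) / (fact n * fact (k + 1))"
    by (subst binomial_fact) auto
  have b2: "(of_nat (n choose k) :: complex) = fact n / (fact k * fact (j + l))"
    by (subst binomial_fact) (auto simp: n)
  have b3: "(of_nat ((2 * k + 2 * j + 2) choose (2 * j)) :: complex)
      = fact (2 * k + 2 * j + 2) / (fact (2 * j) * fact (2 * k + 2))"
    by (subst binomial_fact) auto
  have b4: "(of_nat ((n + 1) choose (k + j + 1)) :: complex)
      = (of_nat n + 1) * fact n / (fact (k + j + 1) * fact l)"
    by (subst binomial_fact) (auto simp: n algebra_simps)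
  have b5: "(of_nat ((j + l) choose j) :: complex) = fact (j + l) / (fact j * fact l)"
    by (subst binomial_fact) auto
  have r: "r n j = fact j * fact (k + l) / fact n * inverse (4 ^ n)
      * (fact (2 * j) / (fact j * fact j)) * (fact (2 * (k + l)) / (fact (k + l) * fact (k + l)))"
  proof -
    have "n - j = k + l" "2 * n - 2 * j = 2 * (k + l)" "2 * j - j = j" by (auto simp: n)
    moreover have "2 * (k + l) - (k + l) = k + l" by simp
    ultimately show ?thesis unfolding r_def by (subst (1 2 3) binomial_fact) (auto simp: n add.commute)
  qed
  have f: "(fact (2 * k + 1) :: complex) = (2 * of_nat k + 1) * fact (2 * k)" by simp
  have pow: "(4 ^ n :: complex) = 4 ^ k * 4 ^ j * 4 ^ l" by (simp add: n power_add)
  have idx: "n - k = j + l" "j + l - j = l" by (auto simp: n)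
  \<comment> \<open>Opaque names keep the simplifier from unfolding the factorials of successors, after which
    the two sides would no longer match.\<close>
  define f1 f2 f3 f4 f5 f6 f7 :: complex
    where "f1 = fact (n + k + 1)" and "f2 = fact (k + 1)" and "f3 = fact (2 * k + 2 * j + 2)"
    and "f4 = fact (2 * k + 2)" and "f5 = fact (k + j + 1)" and "f6 = fact (2 * (k + l))"
    and "f7 = fact (k + l)"
  have nz: "f1 \<noteq> 0" "f2 \<noteq> 0" "f3 \<noteq> 0" "f4 \<noteq> 0" "f5 \<noteq> 0" "f6 \<noteq> 0" "f7 \<noteq> 0"
    by (simp_all only: f1_def f2_def f3_def f4_def f5_def f6_def f7_def fact_nonzero not_False_eq_True)
  have nz': "(of_nat n + 1 :: complex) \<noteq> 0" "(2 * of_nat k + 1 :: complex) \<noteq> 0"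
    by (metis of_nat_Suc of_nat_eq_0_iff nat.distinct(1) add.commute)
       (metis f fact_nonzero mult_zero_left)
  define N K :: complex where "N = of_nat n + 1" and "K = 2 * of_nat k + 1"
  show ?thesis
    unfolding idx p1 p2 p3 b1 b2 b3 b4 b5 r f pow
    unfolding N_def[symmetric] K_def[symmetric] f1_def[symmetric] f2_def[symmetric] f3_def[symmetric] f4_def[symmetric]
      f5_def[symmetric] f6_def[symmetric] f7_def[symmetric]
    using nz nz'[folded N_def K_def] by (simp add: field_simps)
qed

section \<open>The Heun function\<close>

theorem mainTheorem13:
  fixes k n :: nat and x :: complex
  assumes "k \<le> n" and "norm x < 1 / 2"
  shows "Hl (1 / 2) ((2 * of_nat k + 1) * (of_nat k - of_nat n))
           (2 * (of_nat k - of_nat n)) (2 * of_nat k + 1)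
           (2 * of_nat k + 2) (2 * of_nat k + 2) x
         = 4 ^ k * ((2 * of_nat k + 1) / (of_nat n + 1))
           * inverse (of_nat ((n + k + 1) choose n)) * inverse (of_nat (n choose k))
           * (\<Sum>j = 0..n - k. of_nat ((2 * k + 2 * j + 2) choose (2 * j))
                * of_nat ((n + 1) choose (k + j + 1)) * r n j
                * (1 - 2 * x) ^ (2 * n - 2 * k - 2 * j))
       \<and> Hl (1 / 2) ((2 * of_nat k + 1) * (of_nat k - of_nat n))
           (2 * (of_nat k - of_nat n)) (2 * of_nat k + 1)
           (2 * of_nat k + 2) (2 * of_nat k + 2) x
         = (\<Sum>j = 0..n - k. 4 ^ j * of_nat ((n - k) choose j)
              * (pochhammer (of_nat k + 1 / 2) j / pochhammer (2 * of_nat k + 2) j)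
              * (x\<^sup>2 - x) ^ j)"
proof -
  define m where "m = n - k"
  define b c :: complex where "b = of_nat k + 1/2" and "c = 2 * of_nat k + 2"
  define p where "p = hypergeometric_poly m b c"
  define w where "w = x\<^sup>2 - x"
  have c: "c \<noteq> - of_nat i" for i
  proof -
    have "c + of_nat i = of_nat (2 * k + 2 + i)" by (simp add: c_def)
    then show ?thesis 
      by (metis add_2_eq_Suc' add_Suc left_minus add.commute of_nat_eq_0_iff nat.distinct(1))
  qed
  have m: "of_nat m = (of_nat n - of_nat k :: complex)"
    using assms(1) by (simp add: m_def of_nat_diff)
  have "local_heun_solution (1/2)
      ((2 * (of_nat k - of_nat n)) * (2 * of_nat k + 1) / 2)
      (2 * (of_nat k - of_nat n)) (2 * of_nat k + 1) c c (poly (pcompose p [:0, -1, 1:]))"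
  proof (rule heun_symmetric_quadratic_substitution)
    have "4 * (b + 1 - of_nat m) = 2 * (2 * (of_nat k - of_nat n)) + 2 * (2 * of_nat k + 1) + 4"
      "- (4 * of_nat m * b) = 2 * (of_nat k - of_nat n) * (2 * of_nat k + 1)"
      by (simp_all add: b_def m algebra_simps)
    then show "[:0, 1, 4:] * pderiv (pderiv p)
        + [:c, 2 * (2 * (of_nat k - of_nat n)) + 2 * (2 * of_nat k + 1) + 4:] * pderiv p
        + smult (2 * (of_nat k - of_nat n) * (2 * of_nat k + 1)) p = 0"
      using hypergeometric_poly_ode[OF c, of m b] by (simp only: p_def)
    show "poly p 0 = 1"
      by (simp add: p_def poly_0_coeff_0 coeff_hypergeometric_poly)
  qed
  moreover have "poly (pcompose p [:0, -1, 1:]) has_fps_expansion fps_of_poly (pcompose p [:0, -1, 1:])"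
    by (simp add: has_fps_expansion_def)
  ultimately have "Hl (1/2) ((2 * (of_nat k - of_nat n)) * (2 * of_nat k + 1) / 2)
      (2 * (of_nat k - of_nat n)) (2 * of_nat k + 1) c c x
      = eval_fps (fps_of_poly (pcompose p [:0, -1, 1:])) x"
    by (rule Hl_eqI) (use c in auto)
  moreover have "2 * (of_nat k - of_nat n) * (2 * of_nat k + 1) / 2
      = ((2 * of_nat k + 1) * (of_nat k - of_nat n) :: complex)" by simp
  moreover have "eval_fps (fps_of_poly (pcompose p [:0, -1, 1:])) x = poly p w"
    by (simp add: poly_pcompose w_def power2_eq_square algebra_simps)
  ultimately have Hl: "Hl (1/2) ((2 * of_nat k + 1) * (of_nat k - of_nat n))
      (2 * (of_nat k - of_nat n)) (2 * of_nat k + 1) c c x = poly p w"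
    by (simp only:)
  have second: "poly p w = (\<Sum>j = 0..m. 4 ^ j * of_nat (m choose j)
      * (pochhammer b j / pochhammer c j) * w ^ j)"
    by (simp add: p_def hypergeometric_poly_def poly_sum poly_monom atLeast0AtMost)
  \<comment> \<open>\<open>4 * w = - (1 - (1 - 2 * x)\<^sup>2)\<close>: completing the square makes the sum one in powers
    of \<open>1 - y\<close> with \<open>y = (1 - 2 * x)\<^sup>2\<close>.\<close>
  have pow: "4 ^ j * B * Q * w ^ j = (-1) ^ j * B * Q * (1 - (1 - 2 * x)\<^sup>2) ^ j" for j B Q
  proof -
    have "4 ^ j * w ^ j = (-1) ^ j * (1 - (1 - 2 * x)\<^sup>2) ^ j"
      by (simp add: w_def power2_eq_square algebra_simps flip: power_mult_distrib)
    then have "B * Q * (4 ^ j * w ^ j) = B * Q * ((-1) ^ j * (1 - (1 - 2 * x)\<^sup>2) ^ j)"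
      by (simp only:)
    then show ?thesis by (simp only: mult_ac)
  qed
  have "poly p w = (\<Sum>j\<le>m. (-1) ^ j * of_nat (m choose j)
      * (pochhammer b j / pochhammer c j) * (1 - (1 - 2 * x)\<^sup>2) ^ j)"
    by (simp only: second pow atLeast0AtMost)
  also have "\<dots> = (\<Sum>i=0..m. of_nat (m choose i)
      * (pochhammer b i * pochhammer (c - b) (m - i) / pochhammer c m) * ((1 - 2 * x)\<^sup>2) ^ i)"
    by (simp only: hypergeometric_sum_reflect[OF c] atLeast0AtMost)
  \<comment> \<open>The claimed sum is indexed by descending powers of \<open>1 - 2 * x\<close>.\<close>
  also have "\<dots> = (\<Sum>j=0..m. of_nat (m choose (m - j))
      * (pochhammer b (m - j) * pochhammer (c - b) (m - (m - j)) / pochhammer c m)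
      * ((1 - 2 * x)\<^sup>2) ^ (m - j))"
    by (subst sum.atLeastAtMost_rev) simp
  also have "\<dots> = (\<Sum>j=0..m. 4 ^ k * ((2 * of_nat k + 1) / (of_nat n + 1))
           * inverse (of_nat ((n + k + 1) choose n)) * inverse (of_nat (n choose k))
           * (of_nat ((2 * k + 2 * j + 2) choose (2 * j))
                * of_nat ((n + 1) choose (k + j + 1)) * r n j)
           * (1 - 2 * x) ^ (2 * n - 2 * k - 2 * j))"
  proof (rule sum.cong)
    fix j assume "j \<in> {0..m}"
    then have j: "j \<le> n - k" "m choose (m - j) = m choose j" "m - (m - j) = j"
      "2 * n - 2 * k - 2 * j = 2 * (m - j)"
      using binomial_symmetric[of j m] by (auto simp: m_def)
    have cb: "c - b = of_nat k + 3/2" by (simp add: c_def b_def)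
    show "of_nat (m choose (m - j))
      * (pochhammer b (m - j) * pochhammer (c - b) (m - (m - j)) / pochhammer c m)
      * ((1 - 2 * x)\<^sup>2) ^ (m - j) = 4 ^ k * ((2 * of_nat k + 1) / (of_nat n + 1))
           * inverse (of_nat ((n + k + 1) choose n)) * inverse (of_nat (n choose k))
           * (of_nat ((2 * k + 2 * j + 2) choose (2 * j))
                * of_nat ((n + 1) choose (k + j + 1)) * r n j)
           * (1 - 2 * x) ^ (2 * n - 2 * k - 2 * j)"
      unfolding j(2-4) cb binomial_r_eq_pochhammer[OF assms(1) j(1)] power_mult
      by (simp only: b_def c_def m_def)
  qed simp
  finally have first: "poly p w = \<dots>" .
  show ?thesis
    using Hl first second
    by (simp only: b_def c_def m_def w_def sum_distrib_left mult.assoc)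
qed

end
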